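(* Let $\epsilon>0$, $n\ge2$, $N\in\{2n,2n+1\}$ and $p_0$ be given, with $0\le p_0\le p$ (and $p_0=0$ if $N=2n$). Define sequences $T_i$, $Q_i$ by $$T_n=0,\quad T_{n-1}=1,\quad T_i=(4t-2)T_{i+1}-T_{i+2}\quad (i\in\{1,\dots,n-2\}),$$ $$Q_n=1,\quad Q_{n-1}=0,\quad Q_i=(4t-2)Q_{i+1}-Q_{i+2}\quad (i\in\{1,\dots,n-2\}),$$ and define $$a_n=\frac1t,\qquad a_{n-1}=\frac{(2t-1)-8p\sum_{i=1}^nT_iQ_i}{1+8p\sum_{i=1}^nT_i^2}\,a_n,\qquad a_j=(4t-2)a_{j+1}-a_{j+2}\quad (j\in\{1,\dots,n-2\}),$$ together with $a_0=0$ and $a_{-j}=-a_j$. Suppose that $$a_j<a_{j+1}\ \text{ for } j\in\{0,1,\dots,n-1\},\qquad\text{and}\qquad \mathrm{Var}_n[Y\mid x_n^*]\ \ge\ \mathrm{Var}_1[Y\mid x_1^*],$$ where $x_n^*=\frac{a_{n-1}+a_n}{2}$, $x_1^*=\frac{a_1(e^\epsilon p+p-2p^* )}{2(e^\epsilon-1)p}$, and the two quantities are computed from this sequence $a_j$ and the given $p_0$. Then the sequence $(a_j)$ minimizes the worst-case noise variance $\max_{x\in[-1,1]}\mathrm{Var}[Y\mid x]$ among all admissible output sets for the given $\epsilon$, $N$, $p_0$.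
   Context: Structured $N$-output mechanism. Let $\epsilon>0$, $n\ge1$, $N=2n$ or $N=2n+1$. Let $p_0$ be a parameter and set $$p=\frac{1-p_0}{e^\epsilon+2n-1},\qquad p^*=\frac{1-2(n-1)p-e^\epsilon p_0}{2},\qquad t=(e^\epsilon-1)p .$$ It is required that $0\le p_0\le p$; if $N=2n$ then $p_0=0$ (the output $a_0$ is not used and has probability $0$). An admissible output set $\Omega$ is given by reals $a_{-n}<a_{-n+1}<\dots<a_n$ with $a_{-i}=-a_i$, $a_0=0$ and $a_n=1/t$; $\Omega=\{a_i\}_{i=-n}^n$ if $N=2n+1$ and $\Omega=\{a_i\}_{i=-n}^n\setminus\{a_0\}$ if $N=2n$. For $i,j\in\{-n,\dots,n\}$ define $P_{i,j}$ by: for $i=0$: $P_{0,0}=e^\epsilon p_0$ and $P_{0,j}=p_0$ for $j\ne0$; for $|i|>1$: $P_{i,i}=e^\epsilon p$ and $P_{i,j}=p$ for $j\neq i$; for $|i|=1$: $P_{i,i}=e^\epsilon p$, $P_{i,0}=p^*$, and $P_{i,j}=p$ for all other $j$. Put $x_j=\sum_{i=-n}^n a_iP_{i,j}$, which equals $ta_j$; thus $-1=x_{-n}<\dots<x_n=1$. On input $x\in[-1,1]$ the mechanism outputs $a_i$ with probability $p_i(x)$, where $p_i$ is the continuous function that is affine on each $[x_{j-1},x_j]$ with $p_i(x_j)=P_{i,j}$. The noise variance is $\mathrm{Var}[Y\mid x]=\sum_{i=-n}^n a_i^2p_i(x)-x^2$; it is even in $x$. For $j\in\{1,\dots,n\}$,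 $\mathrm{Var}_j[Y\mid x]$ denotes the quadratic polynomial giving $\mathrm{Var}[Y\mid x]$ on $[x_{j-1},x_j]$, evaluated at any real $x$: $$\mathrm{Var}_1[Y\mid x]=-x^2+\frac{a_1(e^\epsilon p+p-2p^* )}{(e^\epsilon-1)p}x+2a_1^2p^*+2\sum_{i=2}^na_i^2p,$$ $$\mathrm{Var}_j[Y\mid x]=-x^2+(a_{j-1}+a_j)x-(e^\epsilon-1)p\,a_{j-1}a_j+2\sum_{i=1}^na_i^2p\qquad(j\ge2).$$ *)

theory Defs
  imports Complex_Main
begin

text \<open>
  The outputs are indexed by the integers from \<open>-n\<close> to \<open>n\<close>, and an output set is given by its
  increasing enumeration \<open>a :: int \<Rightarrow> real\<close>; values of \<open>a\<close> outside that range are irrelevant.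
  For an even number of outputs the index \<open>0\<close> is kept: then \<open>p0 = 0\<close>, so \<open>a 0\<close> has probability 0.
\<close>

definition base_prob :: "real \<Rightarrow> nat \<Rightarrow> real \<Rightarrow> real" where
  "base_prob \<epsilon> n p0 = (1 - p0) / (exp \<epsilon> + 2 * real n - 1)"

definition star_prob :: "real \<Rightarrow> nat \<Rightarrow> real \<Rightarrow> real" where
  "star_prob \<epsilon> n p0 = (1 - 2 * (real n - 1) * base_prob \<epsilon> n p0 - exp \<epsilon> * p0) / 2"

definition slope :: "real \<Rightarrow> nat \<Rightarrow> real \<Rightarrow> real" where
  "slope \<epsilon> n p0 = (exp \<epsilon> - 1) * base_prob \<epsilon> n p0"

definition admissible :: "real \<Rightarrow> nat \<Rightarrow> real \<Rightarrow> (int \<Rightarrow> real) \<Rightarrow> bool" where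
  "admissible \<epsilon> n p0 a \<longleftrightarrow>
     strict_mono_on {- int n..int n} a \<and>
     (\<forall>i\<in>{- int n..int n}. a (- i) = - a i) \<and>
     a 0 = 0 \<and>
     a (int n) = 1 / slope \<epsilon> n p0"

definition trans_prob :: "real \<Rightarrow> nat \<Rightarrow> real \<Rightarrow> int \<Rightarrow> int \<Rightarrow> real" where
  "trans_prob \<epsilon> n p0 i j =
     (if i = 0 then (if j = 0 then exp \<epsilon> * p0 else p0)
      else if j = i then exp \<epsilon> * base_prob \<epsilon> n p0
      else if \<bar>i\<bar> = 1 \<and> j = 0 then star_prob \<epsilon> n p0
      else base_prob \<epsilon> n p0)"

definition node :: "real \<Rightarrow> nat \<Rightarrow> real \<Rightarrow> (int \<Rightarrow> real) \<Rightarrow> int \<Rightarrow> real" where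
  "node \<epsilon> n p0 a j = (\<Sum>i = - int n..int n. a i * trans_prob \<epsilon> n p0 i j)"

text \<open>
  The probability of output \<open>a i\<close> on input \<open>x\<close>: linear interpolation of the values of \<open>trans_prob\<close> at the
  nodes. For admissible \<open>a\<close> the nodes increase strictly from \<open>-1\<close> to \<open>1\<close>, so for \<open>x\<close> in \<open>[-1,1]\<close>
  the set below is nonempty and \<open>x\<close> lies between the nodes \<open>j - 1\<close> and \<open>j\<close>. Inputs outside
  \<open>[-1,1]\<close> are never used.
\<close>

definition out_prob :: "real \<Rightarrow> nat \<Rightarrow> real \<Rightarrow> (int \<Rightarrow> real) \<Rightarrow> int \<Rightarrow> real \<Rightarrow> real" where
  "out_prob \<epsilon> n p0 a i x =
     (let j = Min {k \<in> {- int n + 1..int n}. x \<le> node \<epsilon> n p0 a k};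
          l = node \<epsilon> n p0 a (j - 1);
          r = node \<epsilon> n p0 a j
      in trans_prob \<epsilon> n p0 i (j - 1) + (trans_prob \<epsilon> n p0 i j - trans_prob \<epsilon> n p0 i (j - 1)) * ((x - l) / (r - l)))"

definition noise_var :: "real \<Rightarrow> nat \<Rightarrow> real \<Rightarrow> (int \<Rightarrow> real) \<Rightarrow> real \<Rightarrow> real" where
  "noise_var \<epsilon> n p0 a x = (\<Sum>i = - int n..int n. (a i)\<^sup>2 * out_prob \<epsilon> n p0 a i x) - x\<^sup>2"

text \<open>
  For admissible \<open>a\<close> the variance is continuous on \<open>[-1,1]\<close>, so the supremum is a maximum.
\<close>

definition worst_var :: "real \<Rightarrow> nat \<Rightarrow> real \<Rightarrow> (int \<Rightarrow> real) \<Rightarrow> real" where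
  "worst_var \<epsilon> n p0 a = (SUP x\<in>{-1..1}. noise_var \<epsilon> n p0 a x)"

text \<open>
  The quadratic polynomial that agrees with the variance between the nodes \<open>j - 1\<close> and \<open>j\<close>, for
  \<open>1 \<le> j \<le> n\<close>, as a function on all reals.
\<close>

definition var_piece :: "real \<Rightarrow> nat \<Rightarrow> real \<Rightarrow> (int \<Rightarrow> real) \<Rightarrow> int \<Rightarrow> real \<Rightarrow> real" where
  "var_piece \<epsilon> n p0 a j x =
     (let p = base_prob \<epsilon> n p0; ps = star_prob \<epsilon> n p0 in
      if j = 1
      then - x\<^sup>2 + a 1 * (exp \<epsilon> * p + p - 2 * ps) / ((exp \<epsilon> - 1) * p) * x
           + 2 * (a 1)\<^sup>2 * ps + 2 * (\<Sum>i = 2..int n. (a i)\<^sup>2 * p)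
      else - x\<^sup>2 + (a (j - 1) + a j) * x - (exp \<epsilon> - 1) * p * a (j - 1) * a j
           + 2 * (\<Sum>i = 1..int n. (a i)\<^sup>2 * p))"

end

(*
  Put c = 2 t - 1. The vertex value of the quadratic piece j >= 2 of the variance is
  ((a_(j-1))^2 + (a_j)^2 - 2 c a_(j-1) a_j) / 4 + 2 p sum (a_i)^2. The recurrence makes these values
  equal for j = 2, ..., n, and the formula for a_(n-1) minimises the common value along the
  direction T. The maximum of piece j over its own interval, as a function of the output set, is
  convex, and at a it has the same value and gradient as the vertex value, because the vertex lies
  inside the interval. Since T and a are positive, no direction decreases all these maxima to first
  order, so by convexity every other output set has a piece j >= 2 whose maximum is at least as large.
*)

theory Submission
  imports Defs
begin

section \<open>Inductions on integer intervals and tangent bounds for squares\<close>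

lemma int_interval_const:
  fixes F :: "int \<Rightarrow> 'b"
  assumes step: "\<And>j. m \<le> j \<Longrightarrow> j < n \<Longrightarrow> F j = F (j + 1)" and "m \<le> j" "j \<le> n"
  shows "F j = F n"
  using \<open>j \<le> n\<close> \<open>m \<le> j\<close>
proof (induction j rule: int_le_induct)
  case base
  then show ?case by simp
next
  case (step j)
  then show ?case using assms(1)[of "j - 1"] by simp
qed

lemma int_downward_induct [consumes 2, case_names base step]:
  fixes i n m :: int
  assumes "m \<le> i" "i \<le> n" and base: "P n"
    and step: "\<And>i. m \<le> i \<Longrightarrow> i < n \<Longrightarrow> P (i + 1) \<Longrightarrow> P i"
  shows "P i"
  using assms(2,1)
proof (induction i rule: int_le_induct)
  case base
  then show ?case using assms(3) by simp
next
  case (step j)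
  then show ?case using assms(4)[of "j - 1"] by simp
qed

text \<open>The square of the positive part is convex and has slope \<open>2 * u\<close> at
  \<open>u \<ge> 0\<close>.\<close>

lemma sq_max_tangent:
  fixes u v :: real
  assumes "u \<ge> 0"
  shows "u\<^sup>2 + 2 * u * (v - u) \<le> (max 0 v)\<^sup>2"
proof -
  have "u * v \<le> u * max 0 v"
    using assms by (intro mult_left_mono) auto
  moreover have "0 \<le> (max 0 v - u)\<^sup>2" by simp
  ultimately show ?thesis
    by (simp add: power2_eq_square algebra_simps)
qed

lemma sq_tangent:
  fixes u v :: real
  shows "u\<^sup>2 + 2 * u * (v - u) \<le> v\<^sup>2"
  using zero_le_power2[of "v - u"] by (simp add: power2_eq_square algebra_simps)

section \<open>The recurrence and its convex minimax bound\<close>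

text \<open>\<open>c\<close> stands for \<open>2 * t - 1\<close>. Moving along \<open>T\<close>
  keeps the last output fixed, and \<open>stat\<close> says that the derivative of the vertex value
  of piece \<open>n\<close> in that direction vanishes.\<close>

locale recurrence =
  fixes n :: int and c p :: real and a T :: "int \<Rightarrow> real"
  assumes n2: "2 \<le> n" and c: "-1 < c" "c < 1" and p: "0 < p"
    and a1: "0 < a 1"
    and mono: "\<And>j. 1 \<le> j \<Longrightarrow> j < n \<Longrightarrow> a j < a (j + 1)"
    and rec_a: "\<And>j. 1 \<le> j \<Longrightarrow> j \<le> n - 2 \<Longrightarrow> a j = 2 * c * a (j + 1) - a (j + 2)"
    and T_n: "T n = 0" "T (n - 1) = 1"
    and rec_T: "\<And>j. 1 \<le> j \<Longrightarrow> j \<le> n - 2 \<Longrightarrow> T j = 2 * c * T (j + 1) - T (j + 2)"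
    and stat: "a (n - 1) - c * a n = - 8 * p * (\<Sum>i = 1..n. a i * T i)"
begin

lemma a_pos:
  assumes "1 \<le> j" "j \<le> n"
  shows "0 < a j"
  using assms
proof (induction j rule: int_ge_induct)
  case base
  then show ?case using a1 by simp
next
  case (step j)
  then show ?case using mono[of j] by simp
qed

text \<open>This is the discrete Wronskian of two solutions of the same recurrence, hence conserved;
  its value is read off at \<open>n\<close>.\<close>

lemma wronskian:
  assumes "2 \<le> j" "j \<le> n"
  shows "T (j - 1) * a j - T j * a (j - 1) = a n"
proof -
  have "T (j - 1) * a j - T j * a (j - 1) = T (n - 1) * a n - T n * a (n - 1)"
  proof (rule int_interval_const[where F = "\<lambda>j. T (j - 1) * a j - T j * a (j - 1)", OF _ assms])
    fix k assume "2 \<le> k" "k < n"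
    then have e: "T (k - 1) = 2 * c * T k - T (k + 1)" "a (k - 1) = 2 * c * a k - a (k + 1)"
      using rec_T[of "k - 1"] rec_a[of "k - 1"] by (simp_all add: algebra_simps)
    show "T (k - 1) * a k - T k * a (k - 1) = T (k + 1 - 1) * a (k + 1) - T (k + 1) * a (k + 1 - 1)"
      unfolding e by (simp add: algebra_simps)
  qed
  then show ?thesis using T_n by simp
qed

text \<open>Since \<open>a\<close> is positive, the Wronskian identity passes the sign down from
  \<open>T (i + 1)\<close> to \<open>T i\<close>.\<close>

lemma T_nonneg:
  assumes "1 \<le> j" "j \<le> n"
  shows "0 \<le> T j"
  using assms
proof (induction rule: int_downward_induct)
  case base
  then show ?case using T_n by simp
next
  case (step i)
  then have "T i * a (i + 1) = a n + T (i + 1) * a i"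
    using wronskian[of "i + 1"] by simp
  moreover have "0 \<le> T (i + 1) * a i" "0 < a n" "0 < a (i + 1)"
    using step a_pos[of i] a_pos[of n] a_pos[of "i + 1"] n2 by auto
  ultimately show ?case by (metis add_nonneg_nonneg less_eq_real_def zero_le_mult_iff not_le)
qed

lemma sum_a_T_pos: "0 < (\<Sum>i = 1..n. a i * T i)"
proof (rule sum_pos2)
  show "n - 1 \<in> {1..n}" using n2 by simp
  show "0 < a (n - 1) * T (n - 1)" using a_pos[of "n - 1"] T_n n2 by simp
  show "0 \<le> a i * T i" if "i \<in> {1..n}" for i
    using that a_pos[of i] T_nonneg[of i] by simp
qed simp

text \<open>A positive gap means that the vertex \<open>(a (j - 1) + a j) / 2\<close> lies left of
  the node \<open>t * a j\<close>. At \<open>n\<close> the sign comes from \<open>stat\<close>;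
  below \<open>n\<close> the recurrence turns the gap into
  \<open>a (j + 1) - c * a j\<close>.\<close>

lemma gap_pos:
  assumes "2 \<le> j" "j \<le> n"
  shows "0 < c * a j - a (j - 1)"
proof (cases "j = n")
  case True
  have "0 < 8 * p * (\<Sum>i = 1..n. a i * T i)" using p sum_a_T_pos by simp
  then show ?thesis using True stat by simp
next
  case False
  then have "c * a j - a (j - 1) = a (j + 1) - c * a j"
    using assms rec_a[of "j - 1"] by (simp add: algebra_simps)
  moreover have "c * a j < a j" using c a_pos[of j] assms by simp
  ultimately show ?thesis using mono[of j] False assms by simp
qed

text \<open>A quadratic invariant of the recurrence: four times the part of the vertex value that
  depends on the piece.\<close>

lemma energy_const:
  assumes "2 \<le> j" "j \<le> n"
  shows "(a (j - 1))\<^sup>2 + (a j)\<^sup>2 - 2 * c * a (j - 1) * a j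
       = (a (n - 1))\<^sup>2 + (a n)\<^sup>2 - 2 * c * a (n - 1) * a n"
proof (rule int_interval_const[where F = "\<lambda>j. (a (j - 1))\<^sup>2 + (a j)\<^sup>2 - 2 * c * a (j - 1) * a j", OF _ assms])
  fix k assume "2 \<le> k" "k < n"
  then have e: "a (k - 1) = 2 * c * a k - a (k + 1)"
    using rec_a[of "k - 1"] by (simp add: algebra_simps)
  show "(a (k - 1))\<^sup>2 + (a k)\<^sup>2 - 2 * c * a (k - 1) * a k
      = (a (k + 1 - 1))\<^sup>2 + (a (k + 1))\<^sup>2 - 2 * c * a (k + 1 - 1) * a (k + 1)"
    unfolding e by (simp add: algebra_simps power2_eq_square)
qed

text \<open>Along the direction \<open>T\<close> all pieces change at the same rate, so \<open>stat\<close> makes every one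
  of their gradients orthogonal to \<open>T\<close>.\<close>

lemma stat_all:
  assumes "2 \<le> j" "j \<le> n"
  shows "(a (j - 1) - c * a j) * T (j - 1) + (a j - c * a (j - 1)) * T j
       = - 8 * p * (\<Sum>i = 1..n. a i * T i)"
proof -
  have "(a (j - 1) - c * a j) * T (j - 1) + (a j - c * a (j - 1)) * T j
      = (a (n - 1) - c * a n) * T (n - 1) + (a n - c * a (n - 1)) * T n"
  proof (rule int_interval_const[where F = "\<lambda>j. (a (j - 1) - c * a j) * T (j - 1) + (a j - c * a (j - 1)) * T j", OF _ assms])
    fix k assume "2 \<le> k" "k < n"
    then have e: "T (k - 1) = 2 * c * T k - T (k + 1)" "a (k - 1) = 2 * c * a k - a (k + 1)"
      using rec_T[of "k - 1"] rec_a[of "k - 1"] by (simp_all add: algebra_simps)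
    show "(a (k - 1) - c * a k) * T (k - 1) + (a k - c * a (k - 1)) * T k
       = (a (k + 1 - 1) - c * a (k + 1)) * T (k + 1 - 1) + (a (k + 1) - c * a (k + 1 - 1)) * T (k + 1)"
      unfolding e by (simp add: algebra_simps)
  qed
  then show ?thesis using stat T_n by simp
qed

text \<open>If every piece decreased along \<open>d\<close>, then removing from \<open>d\<close> its \<open>a\<close>-component along \<open>T\<close>
  would leave a direction that is positive yet orthogonal to \<open>a\<close>.\<close>

lemma ex_ascent_piece:
  assumes d: "d n = 0"
  shows "\<exists>j\<in>{2..n}. 0 \<le> (a (j - 1) - c * a j) * d (j - 1) + (a j - c * a (j - 1)) * d j
                      + 8 * p * (\<Sum>i = 1..n. a i * d i)"
proof (rule ccontr)
  assume "\<not> ?thesis"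
  then have neg: "(a (j - 1) - c * a j) * d (j - 1) + (a j - c * a (j - 1)) * d j
                      + 8 * p * (\<Sum>i = 1..n. a i * d i) < 0" if "2 \<le> j" "j \<le> n" for j
    using that by (meson atLeastAtMost_iff not_le)
  define r where "r = (\<Sum>i = 1..n. a i * d i) / (\<Sum>i = 1..n. a i * T i)"
  define f where "f i = d i - r * T i" for i
  have r: "(\<Sum>i = 1..n. a i * d i) = r * (\<Sum>i = 1..n. a i * T i)"
    using sum_a_T_pos by (simp add: r_def)
  have orth: "(\<Sum>i = 1..n. a i * f i) = 0"
    using r by (simp add: f_def algebra_simps sum_subtractf sum_distrib_left)
  \<comment> \<open>Subtracting \<open>r\<close> times \<open>stat_all\<close> from
    \<open>neg\<close> cancels the term with the sum, by the choice of \<open>r\<close>.\<close>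
  have f_step: "(a j - c * a (j - 1)) * f j < (c * a j - a (j - 1)) * f (j - 1)"
    if "2 \<le> j" "j \<le> n" for j
  proof -
    have "(a (j - 1) - c * a j) * (r * T (j - 1)) + (a j - c * a (j - 1)) * (r * T j)
        = - 8 * p * (\<Sum>i = 1..n. a i * d i)"
      using arg_cong[OF stat_all[OF that], of "\<lambda>x. r * x"] r by (simp add: algebra_simps)
    then show ?thesis using neg[OF that] by (simp add: f_def algebra_simps)
  qed
  \<comment> \<open>Both coefficients in \<open>f_step\<close> are positive, so the sign of
    \<open>f\<close> passes downward, starting from \<open>f n = 0\<close>.\<close>
  have f_pos_step: "0 < f (j - 1)" if "2 \<le> j" "j \<le> n" "0 \<le> f j" for j
  proof -
    have "c * a (j - 1) < a (j - 1)" using c a_pos[of "j - 1"] that by simp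
    then have "0 < a j - c * a (j - 1)" using mono[of "j - 1"] that by simp
    then have "0 < (c * a j - a (j - 1)) * f (j - 1)"
      using f_step[of j] that by (smt (verit) mult_nonneg_nonneg)
    then show ?thesis using gap_pos[of j] that by (simp add: zero_less_mult_iff)
  qed
  have f_nonneg: "0 \<le> f j" if "1 \<le> j" "j \<le> n" for j
    using that
  proof (induction rule: int_downward_induct)
    case base
    then show ?case using d T_n by (simp add: f_def)
  next
    case (step i)
    then show ?case using f_pos_step[of "i + 1"] by simp
  qed
  have "0 < (\<Sum>i = 1..n. a i * f i)"
  proof (rule sum_pos2)
    show "n - 1 \<in> {1..n}" using n2 by simp
    show "0 < a (n - 1) * f (n - 1)"
      using f_pos_step[of n] f_nonneg[of n] a_pos[of "n - 1"] n2 by simp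
    show "0 \<le> a i * f i" if "i \<in> {1..n}" for i
      using that a_pos[of i] f_nonneg[of i] by simp
  qed simp
  then show False using orth by simp
qed

text \<open>The left side of the bound is convex in \<open>b\<close>; it is compared with its tangent at \<open>a\<close>.\<close>

lemma minimax:
  assumes b: "b n = a n"
  shows "\<exists>j\<in>{2..n}. ((1 - c\<^sup>2) * (b j)\<^sup>2 + (max 0 (c * b j - b (j - 1)))\<^sup>2) / 4 + 2 * p * (\<Sum>i = 1..n. (b i)\<^sup>2)
     \<ge> ((a (n - 1))\<^sup>2 + (a n)\<^sup>2 - 2 * c * a (n - 1) * a n) / 4 + 2 * p * (\<Sum>i = 1..n. (a i)\<^sup>2)"
proof -
  define d where "d i = b i - a i" for i
  obtain j where j: "2 \<le> j" "j \<le> n" and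
    asc: "0 \<le> (a (j - 1) - c * a j) * d (j - 1) + (a j - c * a (j - 1)) * d j
                      + 8 * p * (\<Sum>i = 1..n. a i * d i)"
    using ex_ascent_piece[of d] b by (auto simp: d_def)
  have c2: "0 \<le> 1 - c\<^sup>2" using c by (simp add: abs_square_le_1 abs_le_iff)
  have 1: "(1 - c\<^sup>2) * ((a j)\<^sup>2 + 2 * a j * d j) \<le> (1 - c\<^sup>2) * (b j)\<^sup>2"
    using mult_left_mono[OF sq_tangent c2] unfolding d_def .
  \<comment> \<open>By \<open>gap_pos\<close> the point of tangency lies where the positive part is
    the identity.\<close>
  have 2: "(c * a j - a (j - 1))\<^sup>2 + 2 * (c * a j - a (j - 1)) * (c * d j - d (j - 1))
      \<le> (max 0 (c * b j - b (j - 1)))\<^sup>2"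
    using sq_max_tangent[of "c * a j - a (j - 1)" "c * b j - b (j - 1)"] gap_pos[OF j]
    by (simp add: d_def algebra_simps)
  have "(\<Sum>i = 1..n. (a i)\<^sup>2 + 2 * (a i * d i)) \<le> (\<Sum>i = 1..n. (b i)\<^sup>2)"
    using sq_tangent by (intro sum_mono) (simp add: d_def mult.assoc)
  then have "(\<Sum>i = 1..n. (a i)\<^sup>2) + 2 * (\<Sum>i = 1..n. a i * d i) \<le> (\<Sum>i = 1..n. (b i)\<^sup>2)"
    by (simp add: sum.distrib sum_distrib_left)
  from mult_left_mono[OF this, of "8 * p"] p
  have 3: "8 * p * (\<Sum>i = 1..n. (a i)\<^sup>2) + 2 * (8 * p * (\<Sum>i = 1..n. a i * d i)) \<le> 8 * p * (\<Sum>i = 1..n. (b i)\<^sup>2)"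
    by (simp add: algebra_simps)
  \<comment> \<open>Completing the square at \<open>a\<close>: the constant terms form the invariant
    of \<open>energy_const\<close>, the linear ones twice the gradient form in
    \<open>asc\<close>.\<close>
  have id: "(1 - c\<^sup>2) * ((a j)\<^sup>2 + 2 * a j * d j)
     + ((c * a j - a (j - 1))\<^sup>2 + 2 * (c * a j - a (j - 1)) * (c * d j - d (j - 1)))
     = (a (j - 1))\<^sup>2 + (a j)\<^sup>2 - 2 * c * a (j - 1) * a j
       + 2 * ((a (j - 1) - c * a j) * d (j - 1) + (a j - c * a (j - 1)) * d j)"
    by (simp add: algebra_simps power2_eq_square)
  have "(a (n - 1))\<^sup>2 + (a n)\<^sup>2 - 2 * c * a (n - 1) * a n + 8 * p * (\<Sum>i = 1..n. (a i)\<^sup>2)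
     \<le> (1 - c\<^sup>2) * (b j)\<^sup>2 + (max 0 (c * b j - b (j - 1)))\<^sup>2 + 8 * p * (\<Sum>i = 1..n. (b i)\<^sup>2)"
  proof -
    \<comment> \<open>The claim multiplied by 4 is a linear combination: \<open>G + D\<close> is the
      ascent quantity, and \<open>E = E'\<close> moves the invariant from piece \<open>j\<close> to
      piece \<open>n\<close>.\<close>
    have "E' + S \<le> A' + B' + S'"
      if "A \<le> A'" "B \<le> B'" "S + 2 * D \<le> S'" "A + B = E + 2 * G" "0 \<le> G + D" "E = E'"
      for A A' B B' S S' D E E' G :: real
      using that by linarith
    then show ?thesis using 1 2 3 id asc energy_const[OF j] .
  qed
  then show ?thesis using j by (intro bexI[of _ j]) (auto simp: field_simps)
qed

end

section \<open>Parameters, nodes and second moments of a mechanism\<close>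

lemma sum_symmetric_interval:
  fixes f :: "int \<Rightarrow> real"
  shows "(\<Sum>i = - int n..int n. f i) = f 0 + (\<Sum>i = 1..int n. f i + f (- i))"
proof -
  have "{- int n..int n} = uminus ` {1..int n} \<union> insert 0 {1..int n}" by auto
  moreover have "sum f (uminus ` {1..int n}) = (\<Sum>i = 1..int n. f (- i))"
    by (subst sum.reindex) (auto simp: inj_on_def)
  moreover have "sum f (uminus ` {1..int n} \<union> insert 0 {1..int n})
      = sum f (uminus ` {1..int n}) + sum f (insert 0 {1..int n})"
    by (rule sum.union_disjoint) auto
  ultimately show ?thesis by (simp add: sum.distrib)
qed

locale mechanism =
  fixes \<epsilon> p0 :: real and n :: nat
  assumes eps: "0 < \<epsilon>" and n1: "1 \<le> n" and p0: "0 \<le> p0" "p0 \<le> base_prob \<epsilon> n p0"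
begin

abbreviation p where "p \<equiv> base_prob \<epsilon> n p0"
abbreviation ps where "ps \<equiv> star_prob \<epsilon> n p0"
abbreviation t where "t \<equiv> slope \<epsilon> n p0"

lemma p_pos: "0 < p"
proof -
  have "1 < exp \<epsilon>" using eps by simp
  then have "exp \<epsilon> + 2 * real n - 1 \<noteq> 0" by linarith
  \<comment> \<open>\<open>p0 = 1\<close> would give \<open>p = 0\<close>, contradicting
    \<open>p0 \<le> p\<close>.\<close>
  moreover have "p0 \<noteq> 1" using p0 by (auto simp: base_prob_def)
  ultimately have "p \<noteq> 0" by (simp add: base_prob_def)
  then show ?thesis using p0 by linarith
qed

lemma t_pos: "0 < t"
  using eps p_pos by (simp add: slope_def)

text \<open>\<open>t\<close> falls short of
  \<open>p * (exp \<epsilon> + 2 * real n - 1) = 1 - p0\<close> by the positive amount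
  \<open>2 * real n * p\<close>.\<close>

lemma t_less_1: "t < 1"
proof -
  have e: "1 < exp \<epsilon>" using eps by simp
  then have "exp \<epsilon> + 2 * real n - 1 \<noteq> 0" by linarith
  then have "p * (exp \<epsilon> + 2 * real n - 1) = 1 - p0"
    by (simp add: base_prob_def)
  moreover have "p * (exp \<epsilon> - 1) < p * (exp \<epsilon> + 2 * real n - 1)"
    using n1 p_pos by (intro mult_strict_left_mono) auto
  ultimately show ?thesis using p0 by (simp add: slope_def mult.commute)
qed

lemma exp_p: "exp \<epsilon> * p = t + p"
  by (simp add: slope_def algebra_simps)

end

locale output_set = mechanism +
  fixes a :: "int \<Rightarrow> real"
  assumes adm: "admissible \<epsilon> n p0 a"
begin

lemma a_less: "- int n \<le> i \<Longrightarrow> i < j \<Longrightarrow> j \<le> int n \<Longrightarrow> a i < a j"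
  using adm by (auto simp: admissible_def strict_mono_on_def)

lemma a_0: "a 0 = 0"
  using adm by (simp add: admissible_def)

lemma a_n: "a (int n) = 1 / t"
  using adm by (simp add: admissible_def)

lemma a_uminus: "- int n \<le> i \<Longrightarrow> i \<le> int n \<Longrightarrow> a (- i) = - a i"
  using adm by (simp add: admissible_def)

definition moment :: "int \<Rightarrow> real" where
  "moment j = (\<Sum>i = - int n..int n. (a i)\<^sup>2 * trans_prob \<epsilon> n p0 i j)"

text \<open>For \<open>j \<noteq> 0\<close> every nonzero output has probability \<open>p\<close>,
  plus an excess \<open>t\<close> on the output \<open>j\<close>; the constant part cancels by
  antisymmetry. In column 0 the outputs cancel in pairs.\<close>

lemma node_eq:
  assumes j: "- int n \<le> j" "j \<le> int n"
  shows "node \<epsilon> n p0 a j = t * a j"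
proof (cases "j = 0")
  case True
  have "a i * trans_prob \<epsilon> n p0 i 0 + a (- i) * trans_prob \<epsilon> n p0 (- i) 0 = 0" if "i \<in> {1..int n}" for i
    using that a_uminus[of i] by (auto simp: trans_prob_def)
  then show ?thesis using True by (simp add: node_def sum_symmetric_interval a_0)
next
  case False
  have "node \<epsilon> n p0 a j = (\<Sum>i = - int n..int n. p * a i + (if i = j then t * a i else 0))"
    unfolding node_def using False
    by (intro sum.cong) (auto simp: trans_prob_def a_0 exp_p algebra_simps)
  also have "\<dots> = p * (\<Sum>i = - int n..int n. a i) + t * a j"
    using j by (simp add: sum.distrib sum_distrib_left)
  also have "(\<Sum>i = - int n..int n. a i) = 0"
    using a_uminus by (simp add: sum_symmetric_interval a_0)
  finally show ?thesis by simp
qed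

lemma moment_nonzero:
  assumes j: "- int n \<le> j" "j \<le> int n" "j \<noteq> 0"
  shows "moment j = 2 * (\<Sum>i = 1..int n. (a i)\<^sup>2 * p) + t * (a j)\<^sup>2"
proof -
  have "moment j = (\<Sum>i = - int n..int n. (a i)\<^sup>2 * p + (if i = j then t * (a i)\<^sup>2 else 0))"
    unfolding moment_def using j
    by (intro sum.cong) (auto simp: trans_prob_def a_0 exp_p algebra_simps)
  also have "\<dots> = (\<Sum>i = - int n..int n. (a i)\<^sup>2 * p) + t * (a j)\<^sup>2"
    using j by (simp add: sum.distrib)
  also have "(\<Sum>i = - int n..int n. (a i)\<^sup>2 * p) = (\<Sum>i = 1..int n. 2 * ((a i)\<^sup>2 * p))"
    unfolding sum_symmetric_interval using a_uminus
    by (auto simp: a_0 intro!: sum.cong)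
  finally show ?thesis by (simp add: sum_distrib_left)
qed

lemma moment_0: "moment 0 = 2 * (a 1)\<^sup>2 * ps + 2 * (\<Sum>i = 2..int n. (a i)\<^sup>2 * p)"
proof -
  have "moment 0 = (\<Sum>i = 1..int n. 2 * ((a i)\<^sup>2 * trans_prob \<epsilon> n p0 i 0))"
    unfolding moment_def sum_symmetric_interval using a_uminus
    by (auto simp: a_0 trans_prob_def intro!: sum.cong)
  also have "{1..int n} = insert 1 {2..int n}" using n1 by auto
  also have "(\<Sum>i\<in>insert 1 {2..int n}. 2 * ((a i)\<^sup>2 * trans_prob \<epsilon> n p0 i 0))
     = 2 * (a 1)\<^sup>2 * ps + (\<Sum>i = 2..int n. 2 * ((a i)\<^sup>2 * p))"
    by (auto simp: trans_prob_def intro!: sum.cong)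
  finally show ?thesis by (simp add: sum_distrib_left)
qed

lemma moment_uminus:
  assumes j: "- int n \<le> j" "j \<le> int n"
  shows "moment (- j) = moment j"
  using assms a_uminus[of j] by (cases "j = 0") (simp_all add: moment_nonzero)

section \<open>The noise variance as a piecewise quadratic\<close>

text \<open>Unlike \<open>var_piece\<close>, this also describes the segments left of 0, which are
  reflected later.\<close>

definition interpolated_var :: "int \<Rightarrow> real \<Rightarrow> real" where
  "interpolated_var j x = moment (j - 1)
     + (moment j - moment (j - 1)) * ((x - t * a (j - 1)) / (t * a j - t * a (j - 1))) - x\<^sup>2"

text \<open>The leftmost node at or above \<open>x\<close> selects the segment, so segments are open
  on the left, except the first, which also takes \<open>x = -1\<close>.\<close>

lemma noise_var_segment:
  assumes j: "- int n < j" "j \<le> int n" and x: "t * a (j - 1) < x \<or> j = - int n + 1" "x \<le> t * a j"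
  shows "noise_var \<epsilon> n p0 a x = interpolated_var j x"
proof -
  have "Min {k \<in> {- int n + 1..int n}. x \<le> node \<epsilon> n p0 a k} = j"
  proof (rule Min_eqI)
    show "finite {k \<in> {- int n + 1..int n}. x \<le> node \<epsilon> n p0 a k}"
      by (rule finite_subset[of _ "{- int n + 1..int n}"]) auto
    show "j \<in> {k \<in> {- int n + 1..int n}. x \<le> node \<epsilon> n p0 a k}"
      using j x node_eq[of j] by auto
    fix k assume "k \<in> {k \<in> {- int n + 1..int n}. x \<le> node \<epsilon> n p0 a k}"
    then have k: "- int n + 1 \<le> k" "k \<le> int n" "x \<le> t * a k" using node_eq[of k] by auto
    show "j \<le> k"
    proof (rule ccontr)
      assume "\<not> j \<le> k"
      then have "t * a k \<le> t * a (j - 1)"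
        using a_less[of k "j - 1"] k j t_pos by (cases "k = j - 1") auto
      then show False using x k \<open>\<not> j \<le> k\<close> by auto
    qed
  qed
  then have out: "out_prob \<epsilon> n p0 a i x = trans_prob \<epsilon> n p0 i (j - 1)
      + (trans_prob \<epsilon> n p0 i j - trans_prob \<epsilon> n p0 i (j - 1))
        * ((x - t * a (j - 1)) / (t * a j - t * a (j - 1)))" for i
    using j node_eq[of j] node_eq[of "j - 1"] unfolding out_prob_def Let_def by simp
  define q where "q = (x - t * a (j - 1)) / (t * a j - t * a (j - 1))"
  have "(\<Sum>i = - int n..int n. (a i)\<^sup>2 * out_prob \<epsilon> n p0 a i x)
      = (\<Sum>i = - int n..int n. (a i)\<^sup>2 * trans_prob \<epsilon> n p0 i (j - 1)
          + ((a i)\<^sup>2 * trans_prob \<epsilon> n p0 i j - (a i)\<^sup>2 * trans_prob \<epsilon> n p0 i (j - 1)) * q)"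
    unfolding out q_def[symmetric] by (simp add: algebra_simps)
  also have "\<dots> = moment (j - 1) + (moment j - moment (j - 1)) * q"
    unfolding moment_def sum.distrib sum_distrib_right[symmetric] sum_subtractf ..
  finally show ?thesis
    by (simp add: noise_var_def interpolated_var_def q_def)
qed

lemma interpolated_var_eq_var_piece:
  assumes j: "1 \<le> j" "j \<le> int n"
  shows "interpolated_var j x = var_piece \<epsilon> n p0 a j x"
proof (cases "j = 1")
  case True
  have a1: "0 < a 1" using a_less[of 0 1] n1 a_0 by simp
  have "{1..int n} = insert 1 {2..int n}" using n1 by auto
  then have m1: "moment 1 = 2 * (a 1)\<^sup>2 * p + 2 * (\<Sum>i = 2..int n. (a i)\<^sup>2 * p) + t * (a 1)\<^sup>2"
    using n1 by (simp add: moment_nonzero algebra_simps)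
  have "(moment 1 - moment 0) * (x / (t * a 1)) = a 1 * (exp \<epsilon> * p + p - 2 * ps) / t * x"
    unfolding m1 moment_0 exp_p using a1 t_pos by (simp add: field_simps power2_eq_square)
  then show ?thesis using True
    by (simp add: interpolated_var_def a_0 var_piece_def Let_def moment_0 slope_def)
next
  case False
  have d: "t * a j - t * a (j - 1) \<noteq> 0" using a_less[of "j - 1" j] j t_pos by simp
  \<comment> \<open>The difference of squares contains the node spacing as a factor, which cancels
    the denominator of the interpolation.\<close>
  have "moment j - moment (j - 1) = (a (j - 1) + a j) * (t * a j - t * a (j - 1))"
    using j False by (simp add: moment_nonzero algebra_simps power2_eq_square)
  then have "(moment j - moment (j - 1)) * ((x - t * a (j - 1)) / (t * a j - t * a (j - 1)))
      = (a (j - 1) + a j) * (x - t * a (j - 1))"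
    using d by simp
  then show ?thesis using j False
    by (simp add: interpolated_var_def var_piece_def Let_def moment_nonzero slope_def[symmetric])
      (simp add: algebra_simps power2_eq_square)
qed

text \<open>Reflection sends the nodes \<open>j - 1\<close> and \<open>j\<close> to
  \<open>1 - j\<close> and \<open>- j\<close>, the ends of segment \<open>1 - j\<close>. Moments are
  even, and the two interpolation weights trade places.\<close>

lemma interpolated_var_reflect:
  assumes j: "- int n < j" "j \<le> int n"
  shows "interpolated_var j x = interpolated_var (1 - j) (- x)"
proof -
  define D where "D = t * a j - t * a (j - 1)"
  have "D \<noteq> 0" using a_less[of "j - 1" j] j t_pos by (simp add: D_def)
  define q where "q = (t * a j - x) / D"
  have "(x - t * a (j - 1)) / D = 1 - q"
    using \<open>D \<noteq> 0\<close> by (simp add: q_def field_simps) (simp add: D_def algebra_simps)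
  then have "interpolated_var j x = moment (j - 1) + (moment j - moment (j - 1)) * (1 - q) - x\<^sup>2"
    unfolding interpolated_var_def D_def by simp
  moreover have "(- x - t * a (- j)) / (t * a (1 - j) - t * a (- j)) = q"
    using a_uminus[of "j - 1"] a_uminus[of j] j by (simp add: q_def D_def)
  then have "interpolated_var (1 - j) (- x) = moment (- j) + (moment (1 - j) - moment (- j)) * q - x\<^sup>2"
    by (simp add: interpolated_var_def)
  moreover have "moment (1 - j) = moment (j - 1)" "moment (- j) = moment j"
    using moment_uminus[of "j - 1"] moment_uminus[of j] j by simp_all
  ultimately show ?thesis by (simp add: algebra_simps)
qed

lemma noise_var_eq_var_piece:
  assumes x: "x \<in> {-1..1}"
  obtains j y where "1 \<le> j" "j \<le> int n" "noise_var \<epsilon> n p0 a x = var_piece \<epsilon> n p0 a j y"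
proof -
  define K where "K = {k \<in> {- int n + 1..int n}. x \<le> t * a k}"
  define j where "j = Min K"
  have K: "finite K" unfolding K_def by (rule finite_subset[of _ "{- int n + 1..int n}"]) auto
  have "int n \<in> K" using x a_n t_pos n1 by (auto simp: K_def)
  then have jK: "j \<in> K" using K by (auto simp: j_def intro: Min_in)
  have "t * a (j - 1) < x \<or> j = - int n + 1"
  proof (rule ccontr)
    assume "\<not> ?thesis"
    then have "j - 1 \<in> K" using jK by (auto simp: K_def)
    then have "j \<le> j - 1" using K unfolding j_def by (meson Min_le)
    then show False by simp
  qed
  then have nv: "noise_var \<epsilon> n p0 a x = interpolated_var j x"
    using jK by (intro noise_var_segment) (auto simp: K_def)
  show ?thesis
  proof (cases "1 \<le> j")
    case True
    then show ?thesis using that[of j x] nv jK interpolated_var_eq_var_piece[of j x] by (simp add: K_def)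
  next
    \<comment> \<open>A segment with \<open>j \<le> 0\<close> is reflected, so the witnesses are
      \<open>1 - j\<close> and \<open>- x\<close>.\<close>
    case False
    then show ?thesis
      using that[of "1 - j" "- x"] nv jK interpolated_var_eq_var_piece[of "1 - j" "- x"]
        interpolated_var_reflect[of j x]
      by (simp add: K_def)
  qed
qed

section \<open>Vertex values and the bounds they give on the worst-case variance\<close>

text \<open>The maximizer of the concave quadratic over all reals, which may lie outside the
  segment; it yields \<open>x1\<close> and \<open>xn\<close> of the theorem.\<close>

definition vertex :: "int \<Rightarrow> real" where
  "vertex j = (if j = 1 then a 1 * (exp \<epsilon> * p + p - 2 * ps) / (2 * (exp \<epsilon> - 1) * p)
               else (a (j - 1) + a j) / 2)"

lemma var_piece_le_vertex: "var_piece \<epsilon> n p0 a j x \<le> var_piece \<epsilon> n p0 a j (vertex j)"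
proof -
  have q: "- x\<^sup>2 + B * x + C \<le> - (B / 2)\<^sup>2 + B * (B / 2) + C" for B C
    using zero_le_power2[of "x - B / 2"] by (simp add: power2_eq_square field_simps)
  have v1: "vertex 1 = (a 1 * (exp \<epsilon> * p + p - 2 * ps) / ((exp \<epsilon> - 1) * p)) / 2"
    by (simp add: vertex_def)
  show ?thesis
  proof (cases "j = 1")
    case True
    then show ?thesis
      using q[of "a 1 * (exp \<epsilon> * p + p - 2 * ps) / ((exp \<epsilon> - 1) * p)"
          "2 * (a 1)\<^sup>2 * ps + 2 * (\<Sum>i = 2..int n. (a i)\<^sup>2 * p)"]
      by (simp only: v1 var_piece_def Let_def refl if_True add.assoc)
  next
    case False
    then show ?thesis
      using q[of "a (j - 1) + a j" "- ((exp \<epsilon> - 1) * p * a (j - 1) * a j) + 2 * (\<Sum>i = 1..int n. (a i)\<^sup>2 * p)"]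
      by (simp add: vertex_def var_piece_def Let_def)
  qed
qed

lemma var_piece_vertex:
  assumes "j \<noteq> 1"
  shows "var_piece \<epsilon> n p0 a j (vertex j)
    = ((a (j - 1))\<^sup>2 + (a j)\<^sup>2 - 2 * (2 * t - 1) * a (j - 1) * a j) / 4 + 2 * p * (\<Sum>i = 1..int n. (a i)\<^sup>2)"
  using assms
  by (simp add: vertex_def var_piece_def Let_def slope_def[symmetric] sum_distrib_right[symmetric])
    (simp add: field_simps power2_eq_square)

text \<open>Boundedness lets the supremum in \<open>worst_var\<close> dominate each value, as
  \<open>worst_var_ge\<close> requires.\<close>

lemma bdd_above_noise_var: "bdd_above (noise_var \<epsilon> n p0 a ` {-1..1})"
proof (rule bdd_aboveI2)
  fix x :: real assume "x \<in> {-1..1}"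
  then obtain j y where j: "1 \<le> j" "j \<le> int n" "noise_var \<epsilon> n p0 a x = var_piece \<epsilon> n p0 a j y"
    by (rule noise_var_eq_var_piece)
  have "noise_var \<epsilon> n p0 a x \<le> var_piece \<epsilon> n p0 a j (vertex j)"
    unfolding j(3) by (rule var_piece_le_vertex)
  also have "\<dots> \<le> Max ((\<lambda>j. var_piece \<epsilon> n p0 a j (vertex j)) ` {1..int n})"
    using j by (intro Max_ge) auto
  finally show "noise_var \<epsilon> n p0 a x \<le> Max ((\<lambda>j. var_piece \<epsilon> n p0 a j (vertex j)) ` {1..int n})" .
qed

lemma worst_var_le:
  assumes "\<And>j. 1 \<le> j \<Longrightarrow> j \<le> int n \<Longrightarrow> var_piece \<epsilon> n p0 a j (vertex j) \<le> M"
  shows "worst_var \<epsilon> n p0 a \<le> M"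
  unfolding worst_var_def
proof (rule cSUP_least)
  fix x :: real assume "x \<in> {-1..1}"
  then obtain j y where "1 \<le> j" "j \<le> int n" "noise_var \<epsilon> n p0 a x = var_piece \<epsilon> n p0 a j y"
    by (rule noise_var_eq_var_piece)
  then show "noise_var \<epsilon> n p0 a x \<le> M"
    using assms[of j] var_piece_le_vertex[of j y] by linarith
qed simp

text \<open>The maximum of the piece \<open>j\<close> over its own interval is attained at the vertex if
  \<open>a (j - 1) < (2 * t - 1) * a j\<close>, and at the right endpoint otherwise.\<close>

lemma worst_var_ge:
  assumes j: "2 \<le> j" "j \<le> int n"
  shows "((1 - (2 * t - 1)\<^sup>2) * (a j)\<^sup>2 + (max 0 ((2 * t - 1) * a j - a (j - 1)))\<^sup>2) / 4
     + 2 * p * (\<Sum>i = 1..int n. (a i)\<^sup>2) \<le> worst_var \<epsilon> n p0 a"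
proof -
  have pos: "0 < a (j - 1)" "a (j - 1) < a j"
    using a_less[of 0 "j - 1"] a_less[of "j - 1" j] a_0 j by simp_all
  have aj: "a j \<le> 1 / t" using a_less[of j "int n"] a_n j by (cases "j = int n") auto
  have ge: "var_piece \<epsilon> n p0 a j x \<le> worst_var \<epsilon> n p0 a" if x: "t * a (j - 1) < x" "x \<le> t * a j" for x
  proof -
    have "t * a j \<le> 1" using aj t_pos by (simp add: field_simps)
    moreover have "0 < t * a (j - 1)" using pos t_pos by simp
    ultimately have "x \<in> {-1..1}" using x by auto
    moreover have "noise_var \<epsilon> n p0 a x = var_piece \<epsilon> n p0 a j x"
      using noise_var_segment[of j x] interpolated_var_eq_var_piece[of j x] x j by simp
    ultimately show ?thesis
      unfolding worst_var_def by (metis cSUP_upper bdd_above_noise_var)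
  qed
  show ?thesis
  proof (cases "a (j - 1) < (2 * t - 1) * a j")
    case True
    \<comment> \<open>Equivalent to the vertex lying right of the node
      \<open>t * a (j - 1)\<close>.\<close>
    have "(2 * t - 1) * a (j - 1) < a j"
    proof -
      have "(2 * t - 1) * a (j - 1) \<le> 1 * a (j - 1)"
        using pos t_less_1 by (intro mult_right_mono) auto
      then show ?thesis using pos by linarith
    qed
    then have "var_piece \<epsilon> n p0 a j (vertex j) \<le> worst_var \<epsilon> n p0 a"
      using True j by (intro ge) (auto simp: vertex_def field_simps)
    then show ?thesis using True j
      by (simp add: var_piece_vertex) (simp add: field_simps power2_eq_square)
  next
    case False
    have "t * a (j - 1) < t * a j" using pos t_pos by simp
    from ge[OF this] have "var_piece \<epsilon> n p0 a j (t * a j) \<le> worst_var \<epsilon> n p0 a" by simp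
    \<comment> \<open>Since \<open>1 - (2 * t - 1)\<^sup>2 = 4 * t * (1 - t)\<close>, the endpoint
      value is the claimed bound with zero positive part.\<close>
    moreover have "var_piece \<epsilon> n p0 a j (t * a j)
        = (1 - (2 * t - 1)\<^sup>2) * (a j)\<^sup>2 / 4 + 2 * p * (\<Sum>i = 1..int n. (a i)\<^sup>2)"
      using j by (simp add: var_piece_def Let_def slope_def[symmetric] sum_distrib_right[symmetric])
        (simp add: field_simps power2_eq_square)
    ultimately show ?thesis using False by simp
  qed
qed

end

section \<open>Matching bounds for the sequence built from \<open>T\<close> and
  \<open>Q\<close>\<close>

theorem theorem4:
  fixes \<epsilon> p0 p ps t xn x1 :: real and n N :: nat and T Q a :: "int \<Rightarrow> real"
  assumes "\<epsilon> > 0" and "n \<ge> 2" and "N = 2 * n \<or> N = 2 * n + 1"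
    and "p = base_prob \<epsilon> n p0" and "ps = star_prob \<epsilon> n p0" and "t = slope \<epsilon> n p0"
    and "0 \<le> p0" and "p0 \<le> p" and "N = 2 * n \<Longrightarrow> p0 = 0"
    and "T (int n) = 0" and "T (int n - 1) = 1"
    and "\<forall>i\<in>{1..int n - 2}. T i = (4 * t - 2) * T (i + 1) - T (i + 2)"
    and "Q (int n) = 1" and "Q (int n - 1) = 0"
    and "\<forall>i\<in>{1..int n - 2}. Q i = (4 * t - 2) * Q (i + 1) - Q (i + 2)"
    and "a (int n) = 1 / t"
    and "a (int n - 1) =
           ((2 * t - 1) - 8 * p * (\<Sum>i = 1..int n. T i * Q i)) /
           (1 + 8 * p * (\<Sum>i = 1..int n. (T i)\<^sup>2)) * a (int n)"
    and "\<forall>j\<in>{1..int n - 2}. a j = (4 * t - 2) * a (j + 1) - a (j + 2)"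
    and "a 0 = 0" and "\<forall>j\<in>{1..int n}. a (- j) = - a j"
    and "\<forall>j\<in>{0..int n - 1}. a j < a (j + 1)"
    and "xn = (a (int n - 1) + a (int n)) / 2"
    and "x1 = a 1 * (exp \<epsilon> * p + p - 2 * ps) / (2 * (exp \<epsilon> - 1) * p)"
    and "var_piece \<epsilon> n p0 a (int n) xn \<ge> var_piece \<epsilon> n p0 a 1 x1"
  shows "is_arg_min (worst_var \<epsilon> n p0) (admissible \<epsilon> n p0) a"
proof -
  have mech: "mechanism \<epsilon> p0 n" using assms(1,2,4,7,8) by unfold_locales auto
  note tp = mechanism.t_pos[OF mech] mechanism.t_less_1[OF mech] mechanism.p_pos[OF mech]
  have inc: "a j < a (j + 1)" if "0 \<le> j" "j < int n" for j
    using assms(21) that by auto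
  have inc': "a j < a (j + 1)" if "- int n \<le> j" "j < int n" for j
  proof (cases "0 \<le> j")
    case True
    then show ?thesis using inc that by simp
  next
    case False
    have "a i = - a (- i)" if "- int n \<le> i" "i \<le> 0" for i
      using assms(19,20) that by (cases "i = 0") (auto dest: bspec[of _ _ "- i"])
    then show ?thesis using False inc[of "- j - 1"] that by simp
  qed
  have less: "a i < a j" if "- int n \<le> i" "i < j" "j \<le> int n" for i j
    using \<open>i < j\<close> \<open>j \<le> int n\<close>
  proof (induction j rule: int_gr_induct)
    case base
    then show ?case using inc'[of i] that by simp
  next
    case (step j)
    then show ?case using inc'[of j] that by simp
  qed
  have "a (- i) = - a i" if "i \<in> {- int n..int n}" for i
    using assms(19,20) that by (cases "0 < i"; cases "i = 0") (auto dest: bspec[of _ _ "- i"])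
  then have adm: "admissible \<epsilon> n p0 a"
    using less assms(6,16,19) by (auto simp: admissible_def strict_mono_on_def)
  interpret A: output_set \<epsilon> p0 n a
    using mech adm by (simp add: output_set_def output_set_axioms_def)

  \<comment> \<open>\<open>T\<close> and \<open>Q\<close> are the fundamental solutions with respect
    to the values at \<open>n - 1\<close> and \<open>n\<close>. The induction carries two neighbours
    because the recurrence has order two.\<close>
  have a_TQ: "a i = T i * a (int n - 1) + Q i * a (int n)" if "1 \<le> i" "i \<le> int n" for i
  proof -
    have "a i = T i * a (int n - 1) + Q i * a (int n)
        \<and> (i < int n \<longrightarrow> a (i + 1) = T (i + 1) * a (int n - 1) + Q (i + 1) * a (int n))"
      using that
    proof (induction rule: int_downward_induct)
      case base
      then show ?case using assms(10,13) by simp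
    next
      case (step i)
      show ?case
      proof (cases "i = int n - 1")
        case True
        then show ?thesis using assms(10,11,13,14) by simp
      next
        case False
        then have i: "i \<in> {1..int n - 2}" using step by auto
        have r: "a i = (4 * t - 2) * a (i + 1) - a (i + 2)"
          "T i = (4 * t - 2) * T (i + 1) - T (i + 2)" "Q i = (4 * t - 2) * Q (i + 1) - Q (i + 2)"
          using i assms(12,15,18) by blast+
        have s: "a (i + 1) = T (i + 1) * a (int n - 1) + Q (i + 1) * a (int n)"
          "a (i + 2) = T (i + 2) * a (int n - 1) + Q (i + 2) * a (int n)"
          using step i by (simp_all add: add.assoc)
        show ?thesis
          unfolding r s by (simp add: algebra_simps)
      qed
    qed
    then show ?thesis ..
  qed
  \<comment> \<open>The sum is linear in \<open>a (int n - 1)\<close> and \<open>a (int n)\<close>;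
    this turns the quotient formula for \<open>a (int n - 1)\<close> into stationarity along
    \<open>T\<close>.\<close>
  have "(\<Sum>i = 1..int n. a i * T i)
      = (\<Sum>i = 1..int n. (T i)\<^sup>2 * a (int n - 1) + T i * Q i * a (int n))"
  proof (intro sum.cong refl)
    fix i assume "i \<in> {1..int n}"
    then have e: "a i = T i * a (int n - 1) + Q i * a (int n)" by (intro a_TQ) auto
    show "a i * T i = (T i)\<^sup>2 * a (int n - 1) + T i * Q i * a (int n)"
      by (subst e) (simp add: power2_eq_square algebra_simps)
  qed
  then have aT: "(\<Sum>i = 1..int n. a i * T i)
      = (\<Sum>i = 1..int n. (T i)\<^sup>2) * a (int n - 1) + (\<Sum>i = 1..int n. T i * Q i) * a (int n)"
    by (simp add: sum.distrib sum_distrib_right)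
  have "0 \<le> 8 * p * (\<Sum>i = 1..int n. (T i)\<^sup>2)"
    using tp assms(4) by (intro mult_nonneg_nonneg sum_nonneg) auto
  then have "1 + 8 * p * (\<Sum>i = 1..int n. (T i)\<^sup>2) \<noteq> 0" by linarith
  then have "a (int n - 1) * (1 + 8 * p * (\<Sum>i = 1..int n. (T i)\<^sup>2))
      = ((2 * t - 1) - 8 * p * (\<Sum>i = 1..int n. T i * Q i)) * a (int n)"
    by (subst assms(17)) simp
  then have stat: "a (int n - 1) - (2 * t - 1) * a (int n) = - 8 * p * (\<Sum>i = 1..int n. a i * T i)"
    unfolding aT by (simp add: algebra_simps)
  interpret R: recurrence "int n" "2 * t - 1" p a T
  proof
    show "a j = 2 * (2 * t - 1) * a (j + 1) - a (j + 2)" if "1 \<le> j" "j \<le> int n - 2" for j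
      using assms(18) that by (simp add: right_diff_distrib)
    show "T j = 2 * (2 * t - 1) * T (j + 1) - T (j + 2)" if "1 \<le> j" "j \<le> int n - 2" for j
      using assms(12) that by (simp add: right_diff_distrib)
    show "0 < a 1" using inc[of 0] assms(2,19) by simp
  qed (use assms tp inc stat in auto)

  define V where "V = var_piece \<epsilon> n p0 a (int n) (A.vertex (int n))"
  have V: "V = ((a (int n - 1))\<^sup>2 + (a (int n))\<^sup>2 - 2 * (2 * t - 1) * a (int n - 1) * a (int n)) / 4
      + 2 * p * (\<Sum>i = 1..int n. (a i)\<^sup>2)"
    unfolding V_def using A.var_piece_vertex[of "int n"] assms(2,4,6) by simp
  have upper: "worst_var \<epsilon> n p0 a \<le> V"
  proof (rule A.worst_var_le)
    fix j :: int assume j: "1 \<le> j" "j \<le> int n"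
    show "var_piece \<epsilon> n p0 a j (A.vertex j) \<le> V"
    proof (cases "j = 1")
      \<comment> \<open>Piece 1 is outside the family equalized by the recurrence; the hypothesis
        comparing it with piece \<open>n\<close> bounds it.\<close>
      case True
      have "A.vertex (int n) = xn" "A.vertex 1 = x1"
        using assms(2,4,5,22,23) by (simp_all add: A.vertex_def)
      then show ?thesis using True assms(24) by (simp add: V_def)
    next
      case False
      then show ?thesis
        using A.var_piece_vertex[of j] R.energy_const[of j] V j assms(4,6) by simp
    qed
  qed
  \<comment> \<open>Every admissible \<open>b\<close> shares the last output \<open>1 / t\<close>,
    which is the condition under which \<open>minimax\<close> compares it with
    \<open>a\<close>.\<close>
  have lower: "V \<le> worst_var \<epsilon> n p0 b" if b: "admissible \<epsilon> n p0 b" for b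
  proof -
    interpret B: output_set \<epsilon> p0 n b
      using mech b by (simp add: output_set_def output_set_axioms_def)
    obtain j where j: "j \<in> {2..int n}" and
      "V \<le> ((1 - (2 * t - 1)\<^sup>2) * (b j)\<^sup>2 + (max 0 ((2 * t - 1) * b j - b (j - 1)))\<^sup>2) / 4
         + 2 * p * (\<Sum>i = 1..int n. (b i)\<^sup>2)"
      using R.minimax[of b] V A.a_n B.a_n by auto
    then show ?thesis using B.worst_var_ge[of j] assms(4,6) by simp
  qed
  show ?thesis
    using adm upper lower unfolding is_arg_min_def by (meson not_le order_trans)
qed

end
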